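(* Let $G$ be a connected, reduced bipartite graph with partite sets $A=\{a_1,\dots,a_m\}$ and $B$, where $m=|A|\le |B|$ and $m=2k$ with $k\ge 3$. Suppose the poset $P_A$ has height $h(P_A)\ge 3$. Then $\mathcal{R}(G)\le k$.
   Context: $N(x)$ denotes the neighborhood of a vertex $x$. A graph is reduced if no two vertices have the same neighborhood. $P_A$ is the poset on $A$ given by $a\preceq b$ iff $N(a)\subseteq N(b)$ (the poset induced by the neighborhood inclusion graph of $G$ with respect to $A$). A chain is a set of pairwise comparable elements; the height $h(P_A)$ is the maximum size of a chain. Letters $x,y$ alternate in a word $w$ if the subsequence of $w$ consisting of occurrences of $x$ and $y$ is $xyxy\cdots$ or $yxyx\cdots$. A word $w$ over the vertex set of a graph (containing every vertex) represents the graph if two vertices are adjacent iff they alternate in $w$. A word is $k$-uniform if each letter occurs exactly $k$ times. $\mathcal{R}(G)$ is the least $k$ such that some $k$-uniform word represents $G$. *)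

theory Defs
  imports
    "Graph_Theory.Digraph_Component"
    "Graph_Theory.Pair_Digraph"
    "HOL-Library.Extended_Nat"
begin

text \<open>
  A finite simple undirected graph is a \<^locale>\<open>pair_graph\<close>: a finite, symmetric, loop-free digraph
  whose arcs are pairs of vertices, an edge being a pair of opposite arcs.
\<close>

definition neighborhood :: "'a pair_pre_digraph \<Rightarrow> 'a \<Rightarrow> 'a set" where
  "neighborhood G x = {y \<in> pverts G. (x, y) \<in> parcs G}"

definition reduced :: "'a pair_pre_digraph \<Rightarrow> bool" where
  "reduced G \<longleftrightarrow>
    (\<forall>x \<in> pverts G. \<forall>y \<in> pverts G. x \<noteq> y \<longrightarrow> neighborhood G x \<noteq> neighborhood G y)"

definition bipartition :: "'a pair_pre_digraph \<Rightarrow> 'a set \<Rightarrow> 'a set \<Rightarrow> bool" where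
  "bipartition G A B \<longleftrightarrow>
    A \<union> B = pverts G \<and> A \<inter> B = {} \<and> parcs G \<subseteq> (A \<times> B) \<union> (B \<times> A)"

definition neighborhood_order :: "'a pair_pre_digraph \<Rightarrow> 'a set \<Rightarrow> 'a rel" where
  "neighborhood_order G A =
    {(a, b). a \<in> A \<and> b \<in> A \<and> neighborhood G a \<subseteq> neighborhood G b}"

text \<open>
  Since \<^const>\<open>Chains\<close> also compares each element with itself, every chain lies in the field of the
  relation. The maximum is meaningful for relations with finite field.
\<close>

definition height :: "'a rel \<Rightarrow> nat" where
  "height r = Max (card ` Chains r)"

definition alternating_word :: "'a \<Rightarrow> 'a \<Rightarrow> nat \<Rightarrow> 'a list" where
  "alternating_word x y n = map (\<lambda>i. if even i then x else y) [0..<n]"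

definition alternate :: "'a list \<Rightarrow> 'a \<Rightarrow> 'a \<Rightarrow> bool" where
  "alternate w x y \<longleftrightarrow>
    (\<exists>n. filter (\<lambda>z. z = x \<or> z = y) w = alternating_word x y n \<or>
         filter (\<lambda>z. z = x \<or> z = y) w = alternating_word y x n)"

definition represents :: "'a list \<Rightarrow> 'a pair_pre_digraph \<Rightarrow> bool" where
  "represents w G \<longleftrightarrow> set w = pverts G \<and>
    (\<forall>x \<in> pverts G. \<forall>y \<in> pverts G. x \<noteq> y \<longrightarrow> ((x, y) \<in> parcs G \<longleftrightarrow> alternate w x y))"

definition uniform_word :: "nat \<Rightarrow> 'a list \<Rightarrow> bool" where
  "uniform_word k w \<longleftrightarrow> (\<forall>x \<in> set w. count_list w x = k)"

text \<open>
  The value is \<open>\<infinity>\<close> if no uniform word represents the graph, so that a finite upper bound always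
  includes the existence of such a word.
\<close>

definition representation_number :: "'a pair_pre_digraph \<Rightarrow> enat" where
  "representation_number G = Inf {enat k | k. \<exists>w. uniform_word k w \<and> represents w G}"

lemma representation_number_le_iff:
  "representation_number G \<le> enat k \<longleftrightarrow>
    (\<exists>j \<le> k. \<exists>w. uniform_word j w \<and> represents w G)" (is "?L \<longleftrightarrow> ?R")
proof
  assume ?L
  let ?S = "{enat j | j. \<exists>w. uniform_word j w \<and> represents w G}"
  from \<open>?L\<close> have "?S \<noteq> {}"
    unfolding representation_number_def by (metis Inf_empty enat_ord_code(5) top_enat_def)
  then have "Inf ?S \<in> ?S"
    by (metis (no_types, lifting) Inf_enat_def LeastI ex_in_conv)
  with \<open>?L\<close> show ?R
    unfolding representation_number_def by auto
next
  assume ?R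
  then obtain j w where "j \<le> k" "uniform_word j w" "represents w G" by blast
  then have "representation_number G \<le> enat j"
    unfolding representation_number_def by (intro Inf_lower) blast
  with \<open>j \<le> k\<close> show ?L by (meson enat_ord_simps(1) order_trans)
qed

lemma partial_order_on_neighborhood_order:
  assumes "reduced G" "A \<subseteq> pverts G"
  shows "partial_order_on A (neighborhood_order G A)"
  using assms
  unfolding partial_order_on_def preorder_on_def refl_on_def trans_def antisym_def
    neighborhood_order_def reduced_def
  by (auto simp: subset_iff) blast

end

theory Submission
  imports Defs Complex_Main
begin

text \<open>
  A word is described by the time \<open>T i x\<close> of the \<open>i\<close>-th occurrence of each letter \<open>x\<close>. Two letters
  fail to alternate as soon as their \<open>i\<close>-th occurrences come in different orders for two values of
  \<open>i\<close>, or one letter is ahead of the other by two occurrences.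

  In each of \<open>k\<close> rounds all of \<open>A\<close> is followed by all of \<open>B\<close>. Split \<open>A\<close> into \<open>k - 1\<close> groups such that
  in a suitable linear order of \<open>B\<close> the neighborhoods of the members of one group are intervals.
  In the round of its group, delay \<open>a\<close> until just before its first neighbor, and advance the next
  occurrence of \<open>a\<close> to just after its last neighbor: then \<open>a\<close> stops alternating with exactly its
  non-neighbors. The last round, with \<open>B\<close> in the order opposite to the one of the first round, makes
  the letters of \<open>B\<close> pairwise non-alternating.

  A chain together with one arbitrary vertex \<open>w\<close> is such a group: list the neighbors of \<open>w\<close> by
  increasing number of neighbors in the chain, then the non-neighbors of \<open>w\<close> by decreasing number.
  With a chain of size 3 the \<open>2 k\<close> vertices of \<open>A\<close> form one group of size 4 and \<open>k - 2\<close> pairs.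
\<close>

section \<open>Words given by the times of their letters\<close>

text \<open>Pairing each letter with its round makes occurrences distinct, so counts become
  cardinalities. Ties in time are broken by the stable sort; the alternation criteria below rest on
  strict inequalities only.\<close>

definition timed_letters :: "(nat \<Rightarrow> 'a \<Rightarrow> real) \<Rightarrow> nat \<Rightarrow> 'a list \<Rightarrow> (nat \<times> 'a) list" where
  "timed_letters T k vs = sort_key (case_prod T) (List.product [0..<k] vs)"

definition timed_word :: "(nat \<Rightarrow> 'a \<Rightarrow> real) \<Rightarrow> nat \<Rightarrow> 'a list \<Rightarrow> 'a list" where
  "timed_word T k vs = map snd (timed_letters T k vs)"

lemma set_timed_letters [simp]: "set (timed_letters T k vs) = {..<k} \<times> set vs"
  by (auto simp: timed_letters_def)

lemma distinct_timed_letters: "distinct vs \<Longrightarrow> distinct (timed_letters T k vs)"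
  by (simp add: timed_letters_def distinct_product)

lemma sorted_timed_letters: "sorted (map (case_prod T) (timed_letters T k vs))"
  by (simp add: timed_letters_def)

lemma count_list_map_snd_filter:
  assumes "distinct ps"
  shows "count_list (map snd (filter P ps)) x = card {i. (i, x) \<in> set ps \<and> P (i, x)}"
proof -
  have "count_list (map snd (filter P ps)) x = length (filter (\<lambda>p. snd p = x \<and> P p) ps)"
    by (induction ps) auto
  also have "\<dots> = card {p \<in> set ps. snd p = x \<and> P p}"
    using assms by (metis distinct_card distinct_filter set_filter)
  also have "{p \<in> set ps. snd p = x \<and> P p} = (\<lambda>i. (i, x)) ` {i. (i, x) \<in> set ps \<and> P (i, x)}"
    by force
  also have "card \<dots> = card {i. (i, x) \<in> set ps \<and> P (i, x)}"
    by (rule card_image) (simp add: inj_on_def)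
  finally show ?thesis .
qed

lemma set_timed_word: "0 < k \<Longrightarrow> set (timed_word T k vs) = set vs"
  by (force simp: timed_word_def)

lemma uniform_timed_word:
  assumes "distinct vs"
  shows "uniform_word k (timed_word T k vs)"
  unfolding uniform_word_def
proof
  fix x assume "x \<in> set (timed_word T k vs)"
  then have "x \<in> set vs" by (auto simp: timed_word_def split: if_splits)
  then show "count_list (timed_word T k vs) x = k"
    using count_list_map_snd_filter[OF distinct_timed_letters[OF assms], of "\<lambda>_. True" T k x]
    by (simp add: timed_word_def lessThan_def[symmetric])
qed

lemma sorted_filter_le_append:
  fixes f :: "'b \<Rightarrow> 'c :: linorder"
  assumes "sorted (map f ps)"
  shows "filter (\<lambda>p. f p \<le> t) ps @ filter (\<lambda>p. \<not> f p \<le> t) ps = ps"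
  using assms
proof (induction ps)
  case (Cons p ps)
  show ?case
  proof (cases "f p \<le> t")
    case False
    with Cons.prems have "\<forall>q \<in> set ps. \<not> f q \<le> t" by (auto intro: order_trans)
    with False show ?thesis by (auto simp: filter_empty_conv filter_id_conv)
  qed (use Cons in auto)
qed simp

text \<open>Cutting at a time \<open>t\<close> turns inequalities between times into statements
  about prefixes. The closed cut keeps all occurrences at time \<open>t\<close> together, so ties do
  no harm.\<close>

lemma timed_word_prefix:
  assumes "distinct vs"
  obtains u v where "timed_word T k vs = u @ v"
    "\<And>x. x \<in> set vs \<Longrightarrow> count_list u x = card {i. i < k \<and> T i x \<le> t}"
proof
  let ?L = "timed_letters T k vs"
  show "timed_word T k vs = map snd (filter (\<lambda>p. case_prod T p \<le> t) ?L)
      @ map snd (filter (\<lambda>p. \<not> case_prod T p \<le> t) ?L)"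
    unfolding timed_word_def map_append[symmetric]
    by (rule arg_cong[OF sorted_filter_le_append[OF sorted_timed_letters, symmetric]])
  show "count_list (map snd (filter (\<lambda>p. case_prod T p \<le> t) ?L)) x = card {i. i < k \<and> T i x \<le> t}"
    if "x \<in> set vs" for x
    using that by (simp add: count_list_map_snd_filter distinct_timed_letters[OF assms])
qed

section \<open>Prefix counts of alternating words\<close>

lemma alternating_word_Suc:
  "alternating_word x y (Suc n) = alternating_word x y n @ [if even n then x else y]"
  by (simp add: alternating_word_def)

lemma count_alternating_word:
  assumes "x \<noteq> y"
  shows "count_list (alternating_word x y n) x = (n + 1) div 2 \<and>
    count_list (alternating_word x y n) y = n div 2"
proof (induction n)
  case 0
  show ?case by (simp add: alternating_word_def)
next
  case (Suc n)
  with assms show ?case by (cases "even n") (simp_all add: alternating_word_Suc)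
qed

lemma take_alternating_word: "take j (alternating_word x y n) = alternating_word x y (min j n)"
proof -
  have "take j [0..<n] = [0..<min j n]" by (cases "j \<le> n") (simp_all add: min_def)
  then show ?thesis by (simp only: alternating_word_def take_map)
qed

text \<open>Filtering a prefix of \<open>w\<close> yields a prefix of the alternating word, hence
  the alternating word of some length \<open>j\<close>. Its two counts are half of \<open>j\<close>,
  rounded up and rounded down.\<close>

lemma filter_alternating_imp_prefix_balanced:
  assumes "filter (\<lambda>z. z = x \<or> z = y) w = alternating_word x y n" "x \<noteq> y" "w = u @ v"
  shows "count_list u y \<le> count_list u x \<and> count_list u x \<le> count_list u y + 1"
proof -
  let ?F = "filter (\<lambda>z. z = x \<or> z = y)"
  have "?F u @ ?F v = alternating_word x y n" using assms(1,3) by simp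
  then have "?F u = take (length (?F u)) (alternating_word x y n)"
    by (metis append_eq_conv_conj)
  then obtain j where "?F u = alternating_word x y j"
    unfolding take_alternating_word by blast
  moreover have "count_list u x = count_list (?F u) x" "count_list u y = count_list (?F u) y"
    by (induction u) auto
  ultimately have "count_list u x = (j + 1) div 2" "count_list u y = j div 2"
    using count_alternating_word[OF assms(2), of j] by simp_all
  then show ?thesis by linarith
qed

text \<open>The leading letter is fixed for the whole word, so the disjunction stands outside the
  quantifiers over prefixes. Two prefixes with opposite leads therefore refute alternation.\<close>

lemma alternate_imp_prefix_balanced:
  assumes "alternate w x y" "x \<noteq> y"
  shows
    "(\<forall>u v. w = u @ v \<longrightarrow>
        count_list u y \<le> count_list u x \<and> count_list u x \<le> count_list u y + 1) \<or>
     (\<forall>u v. w = u @ v \<longrightarrow>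
        count_list u x \<le> count_list u y \<and> count_list u y \<le> count_list u x + 1)"
proof -
  from assms(1) obtain n where
    "filter (\<lambda>z. z = x \<or> z = y) w = alternating_word x y n \<or>
     filter (\<lambda>z. z = x \<or> z = y) w = alternating_word y x n"
    unfolding alternate_def by blast
  moreover have "filter (\<lambda>z. z = y \<or> z = x) w = filter (\<lambda>z. z = x \<or> z = y) w"
    by (simp only: disj_commute)
  ultimately have
    "filter (\<lambda>z. z = x \<or> z = y) w = alternating_word x y n \<or>
     filter (\<lambda>z. z = y \<or> z = x) w = alternating_word y x n"
    by simp
  then show ?thesis
    using filter_alternating_imp_prefix_balanced[of x y w n]
      filter_alternating_imp_prefix_balanced[of y x w n] assms(2) by blast
qed

lemma alternate_commute: "alternate w x y \<longleftrightarrow> alternate w y x"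
  unfolding alternate_def by (simp only: disj_commute)

section \<open>Alternation in terms of occurrence times\<close>

context
  fixes T :: "nat \<Rightarrow> 'a \<Rightarrow> real" and k :: nat and vs :: "'a list"
  assumes distinct: "distinct vs"
    and mono: "\<And>i x. x \<in> set vs \<Longrightarrow> Suc i < k \<Longrightarrow> T i x < T (Suc i) x"
begin

lemma times_mono:
  assumes "x \<in> set vs" "i \<le> j" "j < k"
  shows "T i x \<le> T j x"
  using assms(2,3)
proof (induction j rule: dec_induct)
  case (step j)
  with mono[OF assms(1), of j] show ?case by force
qed simp

lemma Suc_le_card_times_le:
  assumes "x \<in> set vs" "i < k" "T i x \<le> t"
  shows "Suc i \<le> card {j. j < k \<and> T j x \<le> t}"
proof -
  have "{..i} \<subseteq> {j. j < k \<and> T j x \<le> t}"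
    using assms times_mono[OF assms(1)] by (auto intro: order_trans)
  then have "card {..i} \<le> card {j. j < k \<and> T j x \<le> t}" by (intro card_mono) auto
  then show ?thesis by simp
qed

lemma card_times_le_le:
  assumes "x \<in> set vs" "i < k" "t < T i x"
  shows "card {j. j < k \<and> T j x \<le> t} \<le> i"
proof -
  have "{j. j < k \<and> T j x \<le> t} \<subseteq> {..<i}"
  proof
    fix j assume "j \<in> {j. j < k \<and> T j x \<le> t}"
    with times_mono[OF assms(1), of i j] assms(3) show "j \<in> {..<i}"
      by (cases "i \<le> j") auto
  qed
  then have "card {j. j < k \<and> T j x \<le> t} \<le> card {..<i}" by (intro card_mono) auto
  then show ?thesis by simp
qed

text \<open>The prefix up to time \<open>T i x\<close> has at least \<open>i + 1\<close> letters
  \<open>x\<close> and at most \<open>i\<close> letters \<open>y\<close>. The prefix up to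
  \<open>T j y\<close> has more \<open>y\<close> than \<open>x\<close> for the same reason.\<close>

lemma not_alternate_if_swap:
  assumes "x \<in> set vs" "y \<in> set vs" "i < k" "j < k" "T i x < T i y" "T j y < T j x"
  shows "\<not> alternate (timed_word T k vs) x y"
proof
  assume alt: "alternate (timed_word T k vs) x y"
  obtain u v where u: "timed_word T k vs = u @ v"
    "\<And>z. z \<in> set vs \<Longrightarrow> count_list u z = card {l. l < k \<and> T l z \<le> T i x}"
    using timed_word_prefix[OF distinct] by blast
  obtain u' v' where u': "timed_word T k vs = u' @ v'"
    "\<And>z. z \<in> set vs \<Longrightarrow> count_list u' z = card {l. l < k \<and> T l z \<le> T j y}"
    using timed_word_prefix[OF distinct] by blast
  have "count_list u y < count_list u x"
    using Suc_le_card_times_le[of x i "T i x"] card_times_le_le[of y i "T i x"] assms u(2) by simp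
  moreover have "count_list u' x < count_list u' y"
    using Suc_le_card_times_le[of y j "T j y"] card_times_le_le[of x j "T j y"] assms u'(2) by simp
  moreover have "x \<noteq> y" using assms by auto
  note alternate_imp_prefix_balanced[OF alt this]
  ultimately show False
    using u(1) u'(1) by (elim disjE) (meson not_le)+
qed

text \<open>The prefix up to \<open>T (Suc i) x\<close> has at least \<open>i + 2\<close> letters
  \<open>x\<close> but at most \<open>i\<close> letters \<open>y\<close>, a lead of two that neither
  orientation allows.\<close>

lemma not_alternate_if_overtake:
  assumes "x \<in> set vs" "y \<in> set vs" "x \<noteq> y" "Suc i < k" "T (Suc i) x < T i y"
  shows "\<not> alternate (timed_word T k vs) x y"
proof
  assume alt: "alternate (timed_word T k vs) x y"
  obtain u v where u: "timed_word T k vs = u @ v"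
    "\<And>z. z \<in> set vs \<Longrightarrow> count_list u z = card {l. l < k \<and> T l z \<le> T (Suc i) x}"
    using timed_word_prefix[OF distinct] by blast
  have "count_list u y + 1 < count_list u x"
    using Suc_le_card_times_le[of x "Suc i" "T (Suc i) x"] card_times_le_le[of y i "T (Suc i) x"] assms u(2) by simp
  then show False
    using alternate_imp_prefix_balanced[OF alt \<open>x \<noteq> y\<close>] u(1)
    by (elim disjE allE[where x = u] allE[where x = v]) auto
qed

lemma alternate_if_interleaved:
  assumes "x \<in> set vs" "y \<in> set vs" "x \<noteq> y"
    and lt: "\<And>i. i < k \<Longrightarrow> T i x < T i y"
    and lt_Suc: "\<And>i. Suc i < k \<Longrightarrow> T i y < T (Suc i) x"
  shows "alternate (timed_word T k vs) x y"
proof -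
  \<comment> \<open>\<open>p j\<close> is the occurrence expected at position \<open>j\<close> of
    the word starting with \<open>x\<close>; under \<open>lt\<close> and \<open>lt_Suc\<close> its
    times increase strictly.\<close>
  define p where "p j = (j div 2, if even j then x else y)" for j :: nat
  let ?L = "timed_letters T k vs"
  let ?F = "filter (\<lambda>q. snd q = x \<or> snd q = y) ?L"
  have step: "case_prod T (p j) < case_prod T (p (Suc j))" if "Suc j < 2 * k" for j
  proof (cases "even j")
    case True
    with that lt[of "j div 2"] show ?thesis by (auto simp: p_def)
  next
    case False
    then obtain l where "j = 2 * l + 1" by (elim oddE)
    with that lt_Suc[of l] show ?thesis by (simp add: p_def)
  qed
  have less: "case_prod T (p i) < case_prod T (p j)" if "i < j" "j < 2 * k" for i j
    using that
  proof (induction j)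
    case (Suc j)
    then show ?case using step[of j] by (cases "i = j") auto
  qed simp
  have set_eq: "p ` {..<2 * k} = {..<k} \<times> {x, y}"
  proof
    show "p ` {..<2 * k} \<subseteq> {..<k} \<times> {x, y}"
      by (auto simp: p_def)
    have "(i, x) \<in> p ` {..<2 * k}" "(i, y) \<in> p ` {..<2 * k}" if "i < k" for i
      using that image_eqI[of "(i, x)" p "2 * i" "{..<2 * k}"]
        image_eqI[of "(i, y)" p "Suc (2 * i)" "{..<2 * k}"] by (simp_all add: p_def)
    then show "{..<k} \<times> {x, y} \<subseteq> p ` {..<2 * k}" by auto
  qed
  have inj: "inj_on (case_prod T) (p ` {..<2 * k})"
  proof (rule inj_onI)
    fix q r assume "q \<in> p ` {..<2 * k}" "r \<in> p ` {..<2 * k}" "case_prod T q = case_prod T r"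
    then obtain i j where "q = p i" "r = p j" "i < 2 * k" "j < 2 * k" by auto
    with \<open>case_prod T q = case_prod T r\<close> less[of i j] less[of j i] show "q = r"
      by (cases i j rule: linorder_cases) auto
  qed
  have set_F: "set ?F = p ` {..<2 * k}"
    unfolding set_eq using assms(1,2) by auto
  \<comment> \<open>Both lists of times are sorted, distinct and have the same set, so they agree.
    Injectivity of the times on these occurrences then lifts the equality to the
    occurrences.\<close>
  have "map (case_prod T) ?F = map (case_prod T) (map p [0..<2 * k])"
  proof (rule sorted_distinct_set_unique)
    show "sorted (map (case_prod T) ?F)"
      using sorted_timed_letters by (rule sorted_filter)
    show "distinct (map (case_prod T) ?F)"
      using distinct_timed_letters[OF distinct] inj set_F by (simp add: distinct_map)
    have strict: "sorted_wrt (<) (map (case_prod T) (map p [0..<2 * k]))"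
      unfolding sorted_wrt_iff_nth_less using less by simp
    show "sorted (map (case_prod T) (map p [0..<2 * k]))"
      "distinct (map (case_prod T) (map p [0..<2 * k]))"
      using strict by (simp_all only: strict_sorted_iff)
    show "set (map (case_prod T) ?F) = set (map (case_prod T) (map p [0..<2 * k]))"
      by (simp only: list.set_map set_F) (simp add: atLeast0LessThan)
  qed
  then have "?F = map p [0..<2 * k]"
    using inj set_F by (subst (asm) inj_on_map_eq_map) (auto simp: atLeast0LessThan)
  then have "filter (\<lambda>z. z = x \<or> z = y) (timed_word T k vs) = alternating_word x y (2 * k)"
    by (simp add: timed_word_def filter_map comp_def alternating_word_def p_def)
  then show ?thesis unfolding alternate_def by blast
qed

end

section \<open>The word built from groups with interval neighborhoods\<close>

text \<open>\<open>\<kappa> i\<close> places \<open>B\<close> in round \<open>i\<close>;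
  \<open>l a\<close> and \<open>h a\<close> bound the places of the neighbors of \<open>a\<close> in
  round \<open>g a\<close>. The bound on \<open>g\<close> makes \<open>Suc (g a)\<close> a round and
  keeps delays out of the last round. Distinct right ends order the members of a group.\<close>

lemma representation_number_le_if_interval_groups:
  fixes G :: "'a pair_pre_digraph" and k K :: nat
    and g l h :: "'a \<Rightarrow> nat" and \<kappa> :: "nat \<Rightarrow> 'a \<Rightarrow> nat"
  assumes "pair_graph G" and bip: "bipartition G A B" and "3 \<le> k"
    and g: "\<And>a. a \<in> A \<Longrightarrow> g a < k - 1"
    and h: "\<And>a. a \<in> A \<Longrightarrow> h a \<le> K"
    and l: "\<And>a. a \<in> A \<Longrightarrow> l a \<le> h a"
    and \<kappa>: "\<And>i b. b \<in> B \<Longrightarrow> \<kappa> i b \<le> K"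
    and interval: "\<And>a b. a \<in> A \<Longrightarrow> b \<in> B \<Longrightarrow>
      (a, b) \<in> parcs G \<longleftrightarrow> l a \<le> \<kappa> (g a) b \<and> \<kappa> (g a) b \<le> h a"
    and inj: "\<And>a a'. a \<in> A \<Longrightarrow> a' \<in> A \<Longrightarrow> g a = g a' \<Longrightarrow> h a = h a' \<Longrightarrow> a = a'"
  shows "representation_number G \<le> enat k"
proof -
  interpret pair_graph G by fact
  have V: "A \<union> B = pverts G" "A \<inter> B = {}" and arcs: "parcs G \<subseteq> A \<times> B \<union> B \<times> A"
    using bip by (auto simp: bipartition_def)
  have fin: "finite (A \<union> B)" using V by simp
  obtain vs where vs: "set vs = A \<union> B" "distinct vs"
    using finite_distinct_list[OF fin] by blast
  obtain e :: "'a \<Rightarrow> nat" where e: "inj_on e B"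
    using fin by (meson finite_Un finite_imp_inj_to_nat_seg)
  \<comment> \<open>\<open>\<kappa> i\<close> need not be injective. These distinct offsets break
    its ties and, being below 1/2, never carry a letter of \<open>B\<close> past a
    half-integer.\<close>
  define \<epsilon> :: "'a \<Rightarrow> real" where "\<epsilon> b = 1 / (3 + real (e b))" for b
  have eps: "0 < \<epsilon> b" "\<epsilon> b < 1 / 2" for b
    by (auto simp: \<epsilon>_def field_simps)
  have eps_inj: "b = b'" if "b \<in> B" "b' \<in> B" "\<epsilon> b = \<epsilon> b'" for b b'
    using that e by (auto simp: \<epsilon>_def inj_on_def)
  \<comment> \<open>Apart from advanced letters, round \<open>i\<close> lies between
    \<open>i * S - 1 - K\<close> and \<open>i * S + K + 1\<close>, so this length separates the
    rounds.\<close>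
  define S :: real where "S = 4 * real K + 10"
  \<comment> \<open>Relative to \<open>g x * S\<close>, the half-integers \<open>l x - 1 / 2\<close>
    and \<open>h x + 1 / 2\<close> enclose exactly the letters of \<open>B\<close> with keys from
    \<open>l x\<close> to \<open>h x\<close>. The last branch reverses round 0.\<close>
  define T :: "nat \<Rightarrow> 'a \<Rightarrow> real" where "T i x =
    (if x \<in> A then
       if i = Suc (g x) then real (g x) * S + real (h x) + 1 / 2
       else if i = g x then real i * S + real (l x) - 1 / 2
       else real i * S - 1 - real (h x)
     else if i < k - 1 then real i * S + real (\<kappa> i x) + \<epsilon> x
       else real i * S + real K + 1 - real (\<kappa> 0 x) - \<epsilon> x)" for i x
  note real_bounds = h[THEN of_nat_mono[where 'a = real]] l[THEN of_nat_mono[where 'a = real]]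
    \<kappa>[THEN of_nat_mono[where 'a = real]]
  have TA: "T (Suc (g a)) a = real (g a) * S + real (h a) + 1 / 2"
    "T (g a) a = real (g a) * S + real (l a) - 1 / 2"
    "i \<noteq> g a \<Longrightarrow> i \<noteq> Suc (g a) \<Longrightarrow> T i a = real i * S - 1 - real (h a)" if "a \<in> A" for a i
    using that by (simp_all add: T_def)
  have TB: "i < k - 1 \<Longrightarrow> T i b = real i * S + real (\<kappa> i b) + \<epsilon> b"
    "T (k - 1) b = real (k - 1) * S + real K + 1 - real (\<kappa> 0 b) - \<epsilon> b" if "b \<in> B" for b i
    using that V by (auto simp: T_def)
  \<comment> \<open>The subtracted \<open>S - K - 1\<close> lowers the bound to
    \<open>g a * S\<close> for the occurrence that is advanced by one round.\<close>
  have TA_lower: "real i * S - 1 - real K - (if i = Suc (g a) then S - K - 1 else 0) \<le> T i a"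
    if "a \<in> A" for i a
    using that real_bounds(1,2)[OF that] by (auto simp: T_def algebra_simps)
  have TA_upper: "T i a < real i * S + (if i = g a then K else 0)" if "a \<in> A" for i a
    using that real_bounds(1,2)[OF that] by (auto simp: T_def S_def algebra_simps)
  have TB_bounds: "real i * S < T i b" "T i b < real i * S + real K + 1" if "b \<in> B" for i b
    using that V(2) real_bounds(3)[OF that, of i] real_bounds(3)[OF that, of 0] eps[of b]
    by (auto simp: T_def)
  have Suc_S: "real (Suc i) * S = real i * S + S" for i by (simp add: algebra_simps)
  have monoT: "T i x < T (Suc i) x" if "x \<in> set vs" "Suc i < k" for i x
  proof (cases "x \<in> A")
    case True
    consider "i = g x" | "i = Suc (g x)" | "Suc i = g x" | "i \<noteq> g x" "i \<noteq> Suc (g x)" "Suc i \<noteq> g x"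
      by blast
    then show ?thesis
    proof cases
      case 1
      then show ?thesis using TA(1,2)[OF True] real_bounds(2)[OF True] by simp
    next
      case 2
      then show ?thesis
        using TA(1)[OF True] TA(3)[OF True, of "Suc i"] real_bounds(1)[OF True]
        by (simp add: S_def algebra_simps)
    next
      case 3
      then show ?thesis
        using TA(2)[OF True] TA(3)[OF True, of i] real_bounds(1)[OF True]
        by (simp add: S_def algebra_simps flip: 3)
    next
      case 4
      then show ?thesis
        using TA(3)[OF True, of i] TA(3)[OF True, of "Suc i"]
        by (simp add: S_def algebra_simps)
    qed
  next
    case False
    then have "x \<in> B" using that vs by auto
    then show ?thesis
      using TB_bounds[of x i] TB_bounds[of x "Suc i"] Suc_S[of i] by (simp add: S_def)
  qed
  let ?w = "timed_word T k vs"
  note not_swap = not_alternate_if_swap[where T = T and k = k, OF vs(2) monoT]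
  note not_overtake = not_alternate_if_overtake[where T = T and k = k, OF vs(2) monoT]
  \<comment> \<open>Advanced letters precede the rest of their round, which separates different groups. Inside a
    group, the \<open>- real (h x)\<close> in \<open>T\<close> makes ordinary rounds opposite to the advanced one.\<close>
  have AA: "\<not> alternate ?w a a'" if "a \<in> A" "a' \<in> A" "a \<noteq> a'" for a a'
  proof -
    have less_groups: "\<not> alternate ?w a a'" if a: "a \<in> A" "a' \<in> A" "g a < g a'" for a a'
    proof (rule not_swap[of a a' "Suc (g a)" "Suc (g a')"])
      show "T (Suc (g a)) a < T (Suc (g a)) a'"
        using a TA(1)[of a] TA(2)[of a'] TA(3)[of a' "Suc (g a)"] real_bounds(1)[of a] real_bounds(1)[of a'] Suc_S[of "g a"]
        by (cases "g a' = Suc (g a)") (auto simp: S_def algebra_simps)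
      show "T (Suc (g a')) a' < T (Suc (g a')) a"
        using a TA(1)[of a'] TA(3)[of a "Suc (g a')"] real_bounds(1)[of a] real_bounds(1)[of a']
        by (auto simp: S_def algebra_simps)
    qed (use a g[of a] g[of a'] vs in auto)
    have same_group: "\<not> alternate ?w a a'"
      if a: "a \<in> A" "a' \<in> A" "g a = g a'" "h a < h a'" for a a'
    proof -
      \<comment> \<open>Only rounds \<open>g a\<close> and \<open>Suc (g a)\<close> are altered, so
        \<open>3 \<le> k\<close> leaves an ordinary one.\<close>
      obtain r where r: "r < k" "r \<noteq> g a" "r \<noteq> Suc (g a)"
        using \<open>3 \<le> k\<close> that by (cases "g a = 0") (force intro: that[of 2], force intro: that[of 0])
      show ?thesis
        by (rule not_swap[of a a' "Suc (g a)" r])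
          (use a g[of a] vs r TA(1)[of a] TA(1)[of a'] TA(3)[of a r] TA(3)[of a' r] in auto)
    qed
    show ?thesis
      using less_groups[of a a'] less_groups[of a' a] same_group[of a a'] same_group[of a' a]
        that inj[of a a'] alternate_commute[of ?w a a'] by (metis nat_neq_iff)
  qed
  have BB: "\<not> alternate ?w b b'" if b: "b \<in> B" "b' \<in> B" "b \<noteq> b'" for b b'
  proof -
    have *: "\<not> alternate ?w b b'"
      if b: "b \<in> B" "b' \<in> B" "real (\<kappa> 0 b) + \<epsilon> b < real (\<kappa> 0 b') + \<epsilon> b'" for b b'
      by (rule not_swap[of b b' 0 "k - 1"])
        (use b vs \<open>3 \<le> k\<close> TB(1)[of b 0] TB(1)[of b' 0] TB(2)[of b] TB(2)[of b'] in auto)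
    have "real (\<kappa> 0 b) + \<epsilon> b \<noteq> real (\<kappa> 0 b') + \<epsilon> b'"
    proof
      assume eq: "real (\<kappa> 0 b) + \<epsilon> b = real (\<kappa> 0 b') + \<epsilon> b'"
      then have "\<bar>real (\<kappa> 0 b) - real (\<kappa> 0 b')\<bar> < 1"
        using eps[of b] eps[of b'] by linarith
      then have "\<kappa> 0 b = \<kappa> 0 b'" by linarith
      with eq eps_inj b show False by auto
    qed
    then show ?thesis
      using *[of b b'] *[of b' b] b alternate_commute[of ?w b b'] by (metis linorder_neqE)
  qed
  have AB: "(a, b) \<in> parcs G \<longleftrightarrow> alternate ?w a b" if a: "a \<in> A" and b: "b \<in> B" for a b
  proof
    have mem: "a \<in> set vs" "b \<in> set vs" "a \<noteq> b" using a b vs V by auto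
    have ga: "g a < k - 1" "g a < k" "Suc (g a) < k" using g[OF a] by simp_all
    assume "(a, b) \<in> parcs G"
    then have iv: "l a \<le> \<kappa> (g a) b" "\<kappa> (g a) b \<le> h a" using interval a b by auto
    show "alternate ?w a b"
    proof (rule alternate_if_interleaved[where T = T and k = k, OF vs(2) monoT mem])
      fix i
      show "T i a < T i b" if "i < k"
      proof (cases "i = g a")
        case True
        then show ?thesis using TA(2)[OF a] TB(1)[OF b ga(1)] iv eps[of b] by simp
      next
        case False
        then show ?thesis using TA_upper[OF a, of i] TB_bounds[OF b, of i] by simp
      qed
      show "T i b < T (Suc i) a" if "Suc i < k"
      proof (cases "i = g a")
        case True
        then show ?thesis using TA(1)[OF a] TB(1)[OF b ga(1)] iv eps[of b] by simp
      next
        case False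
        then show ?thesis
          using TA_lower[OF a, of "Suc i"] TB_bounds[OF b, of i] Suc_S[of i] by (simp add: S_def)
      qed
    qed
  next
    have mem: "a \<in> set vs" "b \<in> set vs" "a \<noteq> b" using a b vs V by auto
    have ga: "g a < k - 1" "g a < k" "Suc (g a) < k" using g[OF a] by simp_all
    assume alt: "alternate ?w a b"
    show "(a, b) \<in> parcs G"
    proof (rule ccontr)
      assume "(a, b) \<notin> parcs G"
      then consider "\<kappa> (g a) b < l a" | "h a < \<kappa> (g a) b"
        using interval a b by force
      then show False
      proof cases
        case 1
        then have "T (g a) b < T (g a) a"
          using TA(2)[OF a] TB(1)[OF b ga(1)] eps[of b] by simp
        \<comment> \<open>The last round is never the delayed round of \<open>a\<close>, so there
          \<open>a\<close> keeps its place before \<open>B\<close>.\<close>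
        moreover have "T (k - 1) a < T (k - 1) b"
          using TA_upper[OF a, of "k - 1"] TB_bounds[OF b, of "k - 1"] ga by simp
        ultimately show False
          using not_swap[of a b "k - 1" "g a"] mem ga alt by simp
      next
        case 2
        then have "T (Suc (g a)) a < T (g a) b"
          using TA(1)[OF a] TB(1)[OF b ga(1)] eps[of b] by simp
        then show False
          using not_overtake[of a b "g a"] mem ga alt by simp
      qed
    qed
  qed
  have "represents ?w G"
    unfolding represents_def
  proof (intro conjI ballI impI)
    show "set ?w = pverts G" using vs V \<open>3 \<le> k\<close> by (simp add: set_timed_word)
    fix x y assume "x \<in> pverts G" "y \<in> pverts G" "x \<noteq> y"
    then consider "x \<in> A" "y \<in> A" | "x \<in> B" "y \<in> B" | "x \<in> A" "y \<in> B" | "x \<in> B" "y \<in> A"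
      using V by auto
    then show "(x, y) \<in> parcs G \<longleftrightarrow> alternate ?w x y"
    proof cases
      case 1
      then have "(x, y) \<notin> parcs G" using arcs V by auto
      with 1 AA \<open>x \<noteq> y\<close> show ?thesis by simp
    next
      case 2
      then have "(x, y) \<notin> parcs G" using arcs V by auto
      with 2 BB \<open>x \<noteq> y\<close> show ?thesis by simp
    next
      case 3
      with AB show ?thesis by simp
    next
      case 4
      have "(x, y) \<in> parcs G \<longleftrightarrow> (y, x) \<in> parcs G"
        using arcs_symmetric[of x y] arcs_symmetric[of y x] by auto
      with 4 AB[of y x] alternate_commute[of ?w x y] show ?thesis by simp
    qed
  qed
  then show ?thesis
    using uniform_timed_word[OF vs(2)] representation_number_le_iff by blast
qed

section \<open>Groups consisting of a chain and at most one further vertex\<close>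

text \<open>Injectivity of \<open>g\<close> on \<open>W\<close> allows each group at most one vertex
  outside its chain. Reflecting the keys of the non-neighbors of that vertex about
  \<open>n + 1 / 2\<close> makes its neighborhood the lower half, while a chain member gets a
  symmetric interval.\<close>

lemma representation_number_le_if_chain_groups:
  fixes G :: "'a pair_pre_digraph" and k :: nat and g :: "'a \<Rightarrow> nat"
  assumes G: "pair_graph G" and red: "reduced G" and bip: "bipartition G A B" and k: "3 \<le> k"
    and g: "\<And>a. a \<in> A \<Longrightarrow> g a < k - 1"
    and W: "W \<subseteq> A" "inj_on g W"
    and chain: "\<And>a c. a \<in> A - W \<Longrightarrow> c \<in> A - W \<Longrightarrow> g a = g c \<Longrightarrow>
      neighborhood G a \<subseteq> neighborhood G c \<or> neighborhood G c \<subseteq> neighborhood G a"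
  shows "representation_number G \<le> enat k"
proof -
  interpret pair_graph G by fact
  have V: "A \<union> B = pverts G" using bip by (simp add: bipartition_def)
  then have fin: "finite A" by (metis finite_Un finite_verts with_proj_simps(1))
  let ?N = "neighborhood G"
  define n where "n = card A"
  define C where "C i = {c \<in> A - W. g c = i}" for i
  define u where "u i b = card {c \<in> C i. b \<in> ?N c}" for i b
  \<comment> \<open>The rank of \<open>a\<close> counted from the top of its chain, with
    \<open>a\<close> itself included.\<close>
  define \<rho> where "\<rho> a = card {c \<in> C (g a). ?N a \<subseteq> ?N c}" for a
  \<comment> \<open>As \<open>u\<close> is at most \<open>n\<close>, neighbors of \<open>w\<close>
    get keys up to \<open>n\<close> and non-neighbors keys from \<open>n + 1\<close> on. A group
    without \<open>w\<close> simply uses \<open>u\<close>.\<close>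
  define \<kappa> where "\<kappa> i b =
    (if \<exists>w \<in> W. g w = i \<and> b \<notin> ?N w then 2 * n + 1 - u i b else u i b)" for i b
  define l where "l a = (if a \<in> W then 0 else \<rho> a)" for a
  define h where "h a = (if a \<in> W then n else 2 * n + 1 - \<rho> a)" for a
  have finC: "finite (C i)" for i using fin by (simp add: C_def)
  have u_le: "u i b \<le> n" for i b
    unfolding u_def n_def by (rule card_mono) (use fin in \<open>auto simp: C_def\<close>)
  have \<rho>_le: "\<rho> a \<le> n" for a
    unfolding \<rho>_def n_def by (rule card_mono) (use fin in \<open>auto simp: C_def\<close>)
  \<comment> \<open>The chain members adjacent to \<open>b\<close> form an upper segment of the
    chain, so their number decides whether it reaches down to \<open>a\<close>.\<close>
  have mem_iff: "b \<in> ?N a \<longleftrightarrow> \<rho> a \<le> u (g a) b" if a: "a \<in> A - W" for a b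
  proof
    assume "b \<in> ?N a"
    then show "\<rho> a \<le> u (g a) b"
      unfolding \<rho>_def u_def by (intro card_mono) (use finC in auto)
  next
    show "b \<in> ?N a" if le: "\<rho> a \<le> u (g a) b"
    proof (rule ccontr)
      assume b: "b \<notin> ?N a"
      have "?N a \<subseteq> ?N c" if "c \<in> C (g a)" "b \<in> ?N c" for c
        using chain[OF a, of c] b that by (auto simp: C_def)
      then have "{c \<in> C (g a). b \<in> ?N c} \<subseteq> {c \<in> C (g a). ?N a \<subseteq> ?N c} - {a}"
        using b by auto
      also have "\<dots> \<subset> {c \<in> C (g a). ?N a \<subseteq> ?N c}"
        using a by (auto simp: C_def)
      finally have "u (g a) b < \<rho> a"
        unfolding u_def \<rho>_def by (intro psubset_card_mono) (use finC in auto)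
      with le show False by simp
    qed
  qed
  \<comment> \<open>Reducedness makes inclusions in a chain strict, hence ranks distinct; this
    yields the distinct right ends.\<close>
  have \<rho>_less: "\<rho> c < \<rho> a" if "a \<in> A - W" "c \<in> A - W" "g a = g c" "a \<noteq> c" "?N a \<subseteq> ?N c" for a c
  proof -
    have "?N a \<noteq> ?N c" using that red V by (auto simp: reduced_def)
    then have "{d \<in> C (g c). ?N c \<subseteq> ?N d} \<subset> {d \<in> C (g a). ?N a \<subseteq> ?N d}"
      using that by (auto simp: C_def)
    then show ?thesis unfolding \<rho>_def by (intro psubset_card_mono) (use finC in auto)
  qed
  show ?thesis
  proof (rule representation_number_le_if_interval_groups[OF G bip k g])
    fix a assume a: "a \<in> A"
    show "h a \<le> 2 * n + 1" by (simp add: h_def)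
    show "l a \<le> h a" using \<rho>_le[of a] by (auto simp: h_def l_def)
  next
    show "\<kappa> i b \<le> 2 * n + 1" for i b using u_le[of i b] by (simp add: \<kappa>_def)
  next
    fix a b assume a: "a \<in> A" and b: "b \<in> B"
    have arc: "(a, b) \<in> parcs G \<longleftrightarrow> b \<in> ?N a"
      using b V by (auto simp: neighborhood_def)
    show "(a, b) \<in> parcs G \<longleftrightarrow> l a \<le> \<kappa> (g a) b \<and> \<kappa> (g a) b \<le> h a"
    proof (cases "a \<in> W")
      case True
      then have "(\<exists>w \<in> W. g w = g a \<and> b \<notin> ?N w) \<longleftrightarrow> b \<notin> ?N a"
        using W(2) by (auto dest: inj_onD)
      with True arc u_le[of "g a" b] show ?thesis by (auto simp: l_def h_def \<kappa>_def)
    next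
      case False
      with a have "a \<in> A - W" by simp
      from mem_iff[OF this, of b] False arc u_le[of "g a" b] \<rho>_le[of a] show ?thesis
        by (auto simp: l_def h_def \<kappa>_def)
    qed
  next
    fix a c assume ac: "a \<in> A" "c \<in> A" "g a = g c" "h a = h c"
    show "a = c"
    proof (rule ccontr)
      assume "a \<noteq> c"
      \<comment> \<open>Mixed cases cannot tie: \<open>h\<close> is \<open>n\<close> on
        \<open>W\<close> and at least \<open>n + 1\<close> on the chains.\<close>
      consider "a \<in> W" "c \<in> W" | "a \<in> W" "c \<notin> W" | "a \<notin> W" "c \<in> W" | "a \<notin> W" "c \<notin> W" by blast
      then show False
      proof cases
        case 1
        then show False using ac \<open>a \<noteq> c\<close> W(2) by (auto dest: inj_onD)
      next
        case 2
        then show False using ac \<rho>_le[of c] by (simp add: h_def)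
      next
        case 3
        then show False using ac \<rho>_le[of a] by (simp add: h_def)
      next
        case 4
        then have "\<rho> a = \<rho> c" using ac \<rho>_le[of a] \<rho>_le[of c] by (simp add: h_def)
        then show False
          using 4 ac \<open>a \<noteq> c\<close> chain[of a c] \<rho>_less[of a c] \<rho>_less[of c a] by auto
      qed
    qed
  qed
qed

section \<open>Splitting \<open>A\<close> into groups\<close>

text \<open>A finite field makes the maximum attained, and any subset of a chain is a chain, so a
  longer chain can be trimmed to the exact size that the counting needs.\<close>

lemma obtain_chain_of_height:
  assumes "finite (Field r)" "n \<le> height r"
  obtains C where "C \<in> Chains r" "card C = n"
proof -
  have "Chains r \<subseteq> Pow (Field r)"
    by (auto simp: Chains_def Field_def)
  then have fin: "finite (Chains r)" using assms(1) by (meson finite_Pow_iff finite_subset)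
  have "{} \<in> Chains r" by (simp add: Chains_def)
  with fin have "height r \<in> card ` Chains r"
    unfolding height_def by (intro Max_in) auto
  then obtain D where D: "D \<in> Chains r" "n \<le> card D" using assms(2) by auto
  then obtain C where "C \<subseteq> D" "card C = n" by (meson obtain_subset_with_card_n)
  with D(1) show ?thesis by (intro that[of C]) (auto simp: Chains_def)
qed

theorem theorem4:
  fixes G :: "'a pair_pre_digraph" and A B :: "'a set" and m k :: nat
  assumes "pair_graph G"
    and "Digraph_Component.connected (with_proj G)"
    and "reduced G"
    and "bipartition G A B"
    and "card A = m"
    and "m \<le> card B"
    and "m = 2 * k"
    and "k \<ge> 3"
    and "height (neighborhood_order G A) \<ge> 3"
  shows "representation_number G \<le> enat k"
proof -
  let ?r = "neighborhood_order G A"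
  have "finite A" using assms(5,7,8) by (intro card_ge_0_finite) simp
  moreover have "Field ?r \<subseteq> A" by (auto simp: neighborhood_order_def Field_def)
  ultimately have "finite (Field ?r)" by (rule finite_subset[rotated])
  then obtain C where C: "C \<in> Chains ?r" "card C = 3"
    using obtain_chain_of_height assms(9) by blast
  have C_sub: "C \<subseteq> A" using C(1) by (auto simp: Chains_def neighborhood_order_def)
  have "finite C" using C_sub \<open>finite A\<close> finite_subset by blast
  have cards: "card (A - C) = 2 * k - 3"
    using C C_sub \<open>finite C\<close> assms(5,7) by (simp add: card_Diff_subset)
  \<comment> \<open>The remaining \<open>2 * k - 3\<close> vertices split as
    \<open>(k - 1) + (k - 2)\<close>: \<open>W\<close> gives every group its arbitrary vertex,
    \<open>D\<close> gives each group other than that of \<open>C\<close> a chain of size 1.\<close>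
  then have "k - 1 \<le> card (A - C)" using \<open>k \<ge> 3\<close> by simp
  then obtain W where W: "W \<subseteq> A - C" "card W = k - 1"
    by (rule obtain_subset_with_card_n)
  define D where "D = A - C - W"
  have fin: "finite W" "finite D" using W(1) \<open>finite A\<close> finite_subset by (auto simp: D_def)
  have "card D = k - 2"
    using cards W fin(1) \<open>k \<ge> 3\<close> by (simp add: D_def card_Diff_subset)
  \<comment> \<open>Index 0 is kept for the chain \<open>C\<close>.\<close>
  then have "card D = card {1..<k - 1}" by simp
  then obtain q where q: "bij_betw q D {1..<k - 1}"
    using finite_same_card_bij[OF fin(2)] by blast
  have "card W = card {..<k - 1}" using W(2) by simp
  then obtain p where p: "bij_betw p W {..<k - 1}"
    using finite_same_card_bij[OF fin(1)] by blast
  define g where "g a = (if a \<in> C then 0 else if a \<in> W then p a else q a)" for a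
  have q_mem: "q a \<in> {1..<k - 1}" if "a \<in> D" for a using bij_betwE[OF q] that by blast
  have p_mem: "p a < k - 1" if "a \<in> W" for a using bij_betwE[OF p] that by blast
  show ?thesis
  proof (rule representation_number_le_if_chain_groups[OF assms(1,3,4) \<open>k \<ge> 3\<close>])
    show "g a < k - 1" if "a \<in> A" for a
      using that q_mem[of a] p_mem[of a] \<open>k \<ge> 3\<close> by (auto simp: g_def D_def)
    show "W \<subseteq> A" using W(1) by blast
    have "g a = p a" if "a \<in> W" for a using that W(1) by (auto simp: g_def)
    then show "inj_on g W" using p by (simp add: bij_betw_def cong: inj_on_cong)
    show "neighborhood G a \<subseteq> neighborhood G c \<or> neighborhood G c \<subseteq> neighborhood G a"
      if ac: "a \<in> A - W" "c \<in> A - W" "g a = g c" for a c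
    proof -
      consider "a \<in> C" "c \<in> C" | "a \<in> C" "c \<in> D" | "a \<in> D" "c \<in> C" | "a \<in> D" "c \<in> D"
        using ac by (auto simp: D_def)
      then show ?thesis
      proof cases
        case 1
        then show ?thesis using C(1) by (auto simp: Chains_def neighborhood_order_def)
      next
        case 2
        then show ?thesis using ac(3) q_mem[of c] by (auto simp: g_def D_def)
      next
        case 3
        then show ?thesis using ac(3) q_mem[of a] by (auto simp: g_def D_def)
      next
        case 4
        then have "q a = q c" using ac(3) by (auto simp: g_def D_def)
        with 4 q have "a = c" by (auto simp: bij_betw_def dest: inj_onD)
        then show ?thesis by simp
      qed
    qed
  qed
qed

end
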